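(* Fix $\alpha\in(0,1)$ and let $F_{\mathrm{AoN}}(p):=\frac1\alpha\mathbf 1_{\{p\le\alpha\}}$ for $p\in[0,1]$. Among all left-continuous p-to-e calibrators, only $F_{\mathrm{AoN}}$ is set-preserving (at level $\alpha$). That is, $F_{\mathrm{AoN}}$ is set-preserving, and if $F:[0,1]\to[0,\infty]$ is a left-continuous p-to-e calibrator that is set-preserving, then $F=F_{\mathrm{AoN}}$.
   Context: "Decreasing" means non-increasing. A p-variable for a hypothesis $\mathbb H$ is a random variable $P$ with values in $[0,1]$ such that $\mathbb P_{\mathbb H}(P\le\delta)\le\delta$ for all $\delta\in(0,1)$. An e-variable for $\mathbb H$ is a nonnegative random variable $E$ with $\mathbb E_{\mathbb H}[E]\le 1$. A p-to-e calibrator is a decreasing function $F:[0,1]\to[0,\infty]$ such that, for any hypothesis $\mathbb H$ and any p-variable $P$ for $\mathbb H$, $F(P)$ is an e-variable for $\mathbb H$. Conformal p-value: the input space is $\mathcal X\subseteq\mathbb R^d$ and the response space is $\mathcal Y=\mathbb R$. Given a nonconformity score $s:\mathcal X\times\mathcal Y\to\mathbb R$ (e.g. $s(x,y)=|y-\hat\mu(x)|$ for a fitted regressor $\hat\mu:\mathcal X\to\mathbb R$), calibration data $(X_1,Y_1),\dots,(X_n,Y_n)$ and a test input $X_{n+1}$, put $s_i:=s(X_i,Y_i)$ and, for $y\in\mathcal Y$, $$P_n(y):=\frac{1+\sum_{i=1}^n\mathbf 1\{s_i\ge s(X_{n+1},y)\}}{n+1}.$$ The scores are assumed to have a continuous joint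 distribution, so that ties do not occur. A p-to-e calibrator $F$ is set-preserving (at level $\alpha$) if, for all $n$ and for any nonconformity score used to build $P_n$, $$\{y\in\mathcal Y: P_n(y)>\alpha\}=\{y\in\mathcal Y: F(P_n(y))<1/\alpha\}.$$
   Formalization: Uniqueness is proved as F = F_AoN on (0,1] instead of [0,1]: at p = 0 the claim fails, since changing F_AoN(0) to infinity keeps it a left-continuous, set-preserving p-to-e calibrator (p-variables are a.s. nonzero and P_n > 0). *)

theory Defs
  imports "HOL-Probability.Probability"
begin

subsection \<open>P-variables, e-variables and calibrators\<close>

text \<open>A hypothesis is a probability measure \<open>M\<close>.\<close>

definition p_variable :: "'w measure \<Rightarrow> ('w \<Rightarrow> real) \<Rightarrow> bool" where
  "p_variable M P \<longleftrightarrow>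
     P \<in> borel_measurable M \<and> (\<forall>\<omega>\<in>space M. P \<omega> \<in> {0..1}) \<and>
     (\<forall>\<delta>\<in>{0<..<1}. measure M {\<omega> \<in> space M. P \<omega> \<le> \<delta>} \<le> \<delta>)"

definition e_variable :: "'w measure \<Rightarrow> ('w \<Rightarrow> ennreal) \<Rightarrow> bool" where
  "e_variable M E \<longleftrightarrow> E \<in> borel_measurable M \<and> (\<integral>\<^sup>+\<omega>. E \<omega> \<partial>M) \<le> 1"

text \<open>
  Functions on \<open>[0,1]\<close> are represented by functions on the reals of which only the values on
  \<open>{0..1}\<close> are ever used.

  A definition cannot quantify over the type of the sample space, so it is fixed here to be
  \<open>real\<close>. As only the law of \<open>P\<close> matters, this is no restriction; see
  \<open>p_to_e_calibrator_any_space\<close> below.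
\<close>

definition p_to_e_calibrator :: "(real \<Rightarrow> ennreal) \<Rightarrow> bool" where
  "p_to_e_calibrator F \<longleftrightarrow>
     antimono_on {0..1} F \<and>
     (\<forall>(M :: real measure) P. prob_space M \<longrightarrow> p_variable M P \<longrightarrow> e_variable M (\<lambda>\<omega>. F (P \<omega>)))"

text \<open>At \<open>p = 0\<close> left-continuity of a function on \<open>[0,1]\<close> is vacuous.\<close>

definition left_continuous :: "(real \<Rightarrow> ennreal) \<Rightarrow> bool" where
  "left_continuous F \<longleftrightarrow> (\<forall>p\<in>{0<..1}. continuous (at_left p) F)"

definition F_AoN :: "real \<Rightarrow> real \<Rightarrow> ennreal" where
  "F_AoN \<alpha> p = ennreal (1 / \<alpha>) * indicator {..\<alpha>} p"

lemma p_to_e_calibrator_any_space: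
  fixes M :: "'w measure"
  assumes F: "p_to_e_calibrator F" and M: "prob_space M" and P: "p_variable M P"
  shows "e_variable M (\<lambda>\<omega>. F (P \<omega>))"
proof -
  interpret prob_space M by fact
  define clamp :: "real \<Rightarrow> real" where "clamp x = max 0 (min 1 x)" for x
  have [measurable]: "P \<in> borel_measurable M" and P01: "\<And>\<omega>. \<omega> \<in> space M \<Longrightarrow> P \<omega> \<in> {0..1}"
    and Ple: "\<And>\<delta>. \<delta> \<in> {0<..<1} \<Longrightarrow> measure M {\<omega> \<in> space M. P \<omega> \<le> \<delta>} \<le> \<delta>"
    using P by (auto simp: p_variable_def)
  have clamp_meas [measurable]: "clamp \<in> borel_measurable borel"
    unfolding clamp_def by measurable
  have cl: "clamp (P \<omega>) = P \<omega>" if "\<omega> \<in> space M" for \<omega>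
    using P01[OF that] by (auto simp: clamp_def)
  let ?N = "distr M borel P"
  have N: "prob_space ?N" by (rule prob_space_distr) simp
  have "p_variable ?N clamp"
    unfolding p_variable_def
  proof (intro conjI ballI)
    fix \<delta> :: real assume d: "\<delta> \<in> {0<..<1}"
    have "measure ?N {x \<in> space ?N. clamp x \<le> \<delta>} = measure M {\<omega> \<in> space M. P \<omega> \<le> \<delta>}"
      by (subst measure_distr) (auto intro!: arg_cong[where f = "measure M"] simp: cl)
    then show "measure ?N {x \<in> space ?N. clamp x \<le> \<delta>} \<le> \<delta>" using Ple[OF d] by simp
  qed (auto simp: clamp_def)
  with N F have "e_variable ?N (\<lambda>x. F (clamp x))" by (auto simp: p_to_e_calibrator_def)
  then have [measurable]: "(\<lambda>x. F (clamp x)) \<in> borel_measurable borel"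
    and le: "(\<integral>\<^sup>+x. F (clamp x) \<partial>?N) \<le> 1"
    by (auto simp: e_variable_def)
  have "(\<integral>\<^sup>+\<omega>. F (P \<omega>) \<partial>M) = (\<integral>\<^sup>+\<omega>. F (clamp (P \<omega>)) \<partial>M)"
    by (intro nn_integral_cong) (simp add: cl)
  also have "\<dots> = (\<integral>\<^sup>+x. F (clamp x) \<partial>?N)" by (subst nn_integral_distr) auto
  finally have "(\<integral>\<^sup>+\<omega>. F (P \<omega>) \<partial>M) \<le> 1" using le by simp
  moreover have "(\<lambda>\<omega>. F (P \<omega>)) \<in> borel_measurable M \<longleftrightarrow> (\<lambda>\<omega>. F (clamp (P \<omega>))) \<in> borel_measurable M"
    by (intro measurable_cong) (simp add: cl)
  ultimately show ?thesis by (simp add: e_variable_def)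
qed

subsection \<open>Conformal p-values\<close>

text \<open>
  A realisation of the data is a pair \<open>(z, x)\<close>, where \<open>z i = (X\<^sub>i, Y\<^sub>i)\<close> for \<open>i \<in> {1..n}\<close> are the
  calibration data and \<open>x = X\<^sub>n\<^sub>+\<^sub>1\<close> is the test input.
\<close>

definition conformal_pvalue ::
  "nat \<Rightarrow> ('x \<Rightarrow> real \<Rightarrow> real) \<Rightarrow> (nat \<Rightarrow> 'x \<times> real) \<Rightarrow> 'x \<Rightarrow> real \<Rightarrow> real" where
  "conformal_pvalue n s z x y =
     (1 + (\<Sum>i = 1..n. of_bool (s (fst (z i)) (snd (z i)) \<ge> s x y))) / (real n + 1)"

definition data_space :: "nat \<Rightarrow> (real ^ 'd) set \<Rightarrow> ((nat \<Rightarrow> (real ^ 'd) \<times> real) \<times> (real ^ 'd)) measure" where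
  "data_space n \<X> =
     (\<Pi>\<^sub>M i\<in>{1..n}. restrict_space borel \<X> \<Otimes>\<^sub>M borel) \<Otimes>\<^sub>M restrict_space borel \<X>"

definition nonconformity_score :: "(real ^ 'd) set \<Rightarrow> (real ^ 'd \<Rightarrow> real \<Rightarrow> real) \<Rightarrow> bool" where
  "nonconformity_score \<X> s \<longleftrightarrow>
     (\<lambda>(x, y). s x y) \<in> borel_measurable (restrict_space borel \<X> \<Otimes>\<^sub>M borel)"

text \<open>
  \<open>Q\<close> is the joint law of the data. A continuous joint distribution of the calibration scores is
  one with a joint density, i.e. absolutely continuous with respect to Lebesgue measure: merely
  having no atoms would not exclude ties.
\<close>

definition continuous_scores ::
  "nat \<Rightarrow> (real ^ 'd \<Rightarrow> real \<Rightarrow> real) \<Rightarrow> ((nat \<Rightarrow> (real ^ 'd) \<times> real) \<times> (real ^ 'd)) measure \<Rightarrow> bool" where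
  "continuous_scores n s Q \<longleftrightarrow>
     absolutely_continuous (\<Pi>\<^sub>M i\<in>{1..n}. lborel)
       (distr Q (\<Pi>\<^sub>M i\<in>{1..n}. lborel) (\<lambda>(z, x). \<lambda>i\<in>{1..n}. s (fst (z i)) (snd (z i))))"

text \<open>The two sets are random; their equality is understood almost surely.\<close>

definition set_preserving :: "real \<Rightarrow> (real ^ 'd) set \<Rightarrow> (real \<Rightarrow> ennreal) \<Rightarrow> bool" where
  "set_preserving \<alpha> \<X> F \<longleftrightarrow>
     (\<forall>n s Q. nonconformity_score \<X> s \<longrightarrow>
        prob_space Q \<longrightarrow> sets Q = sets (data_space n \<X>) \<longrightarrow> continuous_scores n s Q \<longrightarrow>
        (AE (z, x) in Q. {y. conformal_pvalue n s z x y > \<alpha>}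
                       = {y. F (conformal_pvalue n s z x y) < ennreal (1 / \<alpha>)}))"

subsection \<open>The value at zero is not determined\<close>

text \<open>
  A p-variable vanishes with probability zero and conformal p-values are positive, so the properties
  above do not constrain \<open>F 0\<close> beyond monotonicity: raising it to \<open>\<infinity>\<close> preserves all of them.
  Uniqueness of a set-preserving calibrator is therefore only possible on \<open>(0,1]\<close>.
\<close>

lemma left_continuous_upd_zero: "left_continuous (F(0 := v)) \<longleftrightarrow> left_continuous F"
proof -
  have "continuous (at_left p) (F(0 := v)) \<longleftrightarrow> continuous (at_left p) F" if "p > 0" for p :: real
    unfolding continuous_within
  proof (intro filterlim_cong)
    show "eventually (\<lambda>x. (F(0 := v)) x = F x) (at_left p)"
      using eventually_at_left_real[OF that] by eventually_elim auto
  qed (use that in auto)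
  then show ?thesis by (auto simp: left_continuous_def)
qed

lemma conformal_pvalue_pos: "conformal_pvalue n s z x y > 0"
proof -
  have "0 \<le> (\<Sum>i = 1..n. of_bool (s (fst (z i)) (snd (z i)) \<ge> s x y) :: real)"
    by (intro sum_nonneg) simp
  then show ?thesis
    unfolding conformal_pvalue_def by (intro divide_pos_pos) linarith+
qed

lemma set_preserving_upd_zero:
  fixes \<X> :: "(real ^ 'd) set"
  shows "set_preserving \<alpha> \<X> (F(0 := v)) \<longleftrightarrow> set_preserving \<alpha> \<X> F"
proof -
  have "(F(0 := v)) (conformal_pvalue n s z x y) = F (conformal_pvalue n s z x y)"
    for n s and z :: "nat \<Rightarrow> (real ^ 'd) \<times> real" and x y
    using conformal_pvalue_pos[of n s z x y] by simp
  then show ?thesis by (simp only: set_preserving_def)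
qed

lemma p_to_e_calibrator_upd_zero:
  assumes "p_to_e_calibrator F"
  shows "p_to_e_calibrator (F(0 := \<infinity>))"
  unfolding p_to_e_calibrator_def
proof (intro conjI allI impI)
  show "antimono_on {0..1} (F(0 := \<infinity>))"
    using assms by (auto simp: p_to_e_calibrator_def monotone_on_def)
next
  fix M :: "real measure" and P
  assume M: "prob_space M" and P: "p_variable M P"
  interpret prob_space M by fact
  have [measurable]: "P \<in> borel_measurable M"
    and Ple: "\<And>\<delta>. \<delta> \<in> {0<..<1} \<Longrightarrow> measure M {\<omega> \<in> space M. P \<omega> \<le> \<delta>} \<le> \<delta>"
    using P by (auto simp: p_variable_def)
  have le: "measure M {\<omega> \<in> space M. P \<omega> = 0} \<le> \<delta>" if "\<delta> > 0" for \<delta>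
  proof -
    have "min \<delta> (1 / 2) \<in> {0<..<1}" using that by auto
    then have "measure M {\<omega> \<in> space M. P \<omega> \<le> min \<delta> (1 / 2)} \<le> min \<delta> (1 / 2)" by (rule Ple)
    moreover have "measure M {\<omega> \<in> space M. P \<omega> = 0} \<le> measure M {\<omega> \<in> space M. P \<omega> \<le> min \<delta> (1 / 2)}"
      using that by (intro finite_measure_mono) auto
    ultimately show ?thesis by simp
  qed
  have "measure M {\<omega> \<in> space M. P \<omega> = 0} \<le> 0"
    by (rule field_le_epsilon) (use le in simp)
  then have "measure M {\<omega> \<in> space M. P \<omega> = 0} = 0"
    using measure_nonneg[of M "{\<omega> \<in> space M. P \<omega> = 0}"] by linarith
  then have ae: "AE \<omega> in M. P \<omega> \<noteq> 0"
    by (subst AE_iff_measurable[OF _ refl]) (auto simp: emeasure_eq_measure)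
  have e: "e_variable M (\<lambda>\<omega>. F (P \<omega>))" using assms M P by (auto simp: p_to_e_calibrator_def)
  then have [measurable]: "(\<lambda>\<omega>. F (P \<omega>)) \<in> borel_measurable M" by (simp add: e_variable_def)
  have "(\<lambda>\<omega>. (F(0 := \<infinity>)) (P \<omega>)) = (\<lambda>\<omega>. if P \<omega> = 0 then \<infinity> else F (P \<omega>))" by auto
  then have meas: "(\<lambda>\<omega>. (F(0 := \<infinity>)) (P \<omega>)) \<in> borel_measurable M" by simp
  have "(\<integral>\<^sup>+\<omega>. (F(0 := \<infinity>)) (P \<omega>) \<partial>M) = (\<integral>\<^sup>+\<omega>. F (P \<omega>) \<partial>M)"
    by (intro nn_integral_cong_AE eventually_mono[OF ae]) simp
  with e meas show "e_variable M (\<lambda>\<omega>. (F(0 := \<infinity>)) (P \<omega>))" by (simp add: e_variable_def)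
qed

end

theory Submission
  imports Defs
begin

text \<open>
  A set-preserving \<open>F\<close> is at least \<open>1 / \<alpha>\<close> at the rationals up to \<open>\<alpha>\<close>, since every rational in
  \<open>(0,1]\<close> is a conformal p-value for suitable data; by left-continuity and monotonicity it is at
  least \<open>1 / \<alpha>\<close> on all of \<open>(0,\<alpha>]\<close>. Then \<open>(0,\<alpha>]\<close> alone uses up the whole budget
  \<open>\<integral>\<^sub>0\<^sup>1 F \<le> 1\<close> of a calibrator, so \<open>F\<close> can neither exceed \<open>1 / \<alpha>\<close> there nor be positive beyond \<open>\<alpha>\<close>.
\<close>

text \<open>Every point has a left neighbourhood on which the function equals its value at that
  point: everything to the left of some p \<le> \<alpha> stays in \<open>{..\<alpha>}\<close>, and
  for p > \<alpha> the interval between \<alpha> and p avoids it. The jump at \<alpha> is visible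
  only from the right.\<close>

lemma left_continuous_F_AoN: "left_continuous (F_AoN \<alpha>)"
proof -
  have "continuous (at_left p) (F_AoN \<alpha>)" for p :: real
    unfolding continuous_within
  proof (rule tendsto_eventually)
    show "eventually (\<lambda>x. F_AoN \<alpha> x = F_AoN \<alpha> p) (at_left p)"
    proof (cases "p \<le> \<alpha>")
      case True
      then show ?thesis
        by (auto simp: F_AoN_def eventually_at_filter indicator_def)
    next
      case False
      then have "eventually (\<lambda>x. x \<in> {\<alpha><..<p}) (at_left p)"
        by (intro eventually_at_left_real) simp
      then show ?thesis
        by eventually_elim (auto simp: F_AoN_def indicator_def)
    qed
  qed
  then show ?thesis by (simp add: left_continuous_def)
qed

lemma F_AoN_less_iff:
  assumes "0 < \<alpha>"
  shows "F_AoN \<alpha> p < ennreal (1 / \<alpha>) \<longleftrightarrow> \<alpha> < p"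
  using assms by (auto simp: F_AoN_def indicator_def)

lemma set_preserving_F_AoN:
  assumes "0 < \<alpha>"
  shows "set_preserving \<alpha> \<X> (F_AoN \<alpha>)"
  using assms by (simp add: set_preserving_def F_AoN_less_iff)

lemma p_to_e_calibrator_F_AoN:
  assumes "0 < \<alpha>" "\<alpha> < 1"
  shows "p_to_e_calibrator (F_AoN \<alpha>)"
  unfolding p_to_e_calibrator_def
proof (intro conjI allI impI)
  show "antimono_on {0..1} (F_AoN \<alpha>)"
    by (auto simp: monotone_on_def F_AoN_def indicator_def)
next
  fix M :: "real measure" and P
  assume "prob_space M" and P: "p_variable M P"
  interpret prob_space M by fact
  have [measurable]: "P \<in> borel_measurable M"
    and le: "prob {\<omega> \<in> space M. P \<omega> \<le> \<alpha>} \<le> \<alpha>"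
    using P assms by (auto simp: p_variable_def)
  have "(\<integral>\<^sup>+\<omega>. F_AoN \<alpha> (P \<omega>) \<partial>M)
      = (\<integral>\<^sup>+\<omega>. ennreal (1 / \<alpha>) * indicator {\<omega> \<in> space M. P \<omega> \<le> \<alpha>} \<omega> \<partial>M)"
    by (intro nn_integral_cong) (auto simp: F_AoN_def indicator_def)
  also have "\<dots> = ennreal (1 / \<alpha> * prob {\<omega> \<in> space M. P \<omega> \<le> \<alpha>})"
    using assms by (simp add: nn_integral_cmult_indicator emeasure_eq_measure flip: ennreal_mult)
  also have "\<dots> \<le> 1"
    using le assms by (simp add: field_simps)
  finally show "e_variable M (\<lambda>\<omega>. F_AoN \<alpha> (P \<omega>))"
    unfolding e_variable_def F_AoN_def by simp
qed

text \<open>A uniform variable on [0,1] is a p-variable, so F has integral at most 1 over [0,1];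
  since F decreases, it dominates the step function with value \<open>F a\<close> on
  \<open>{0..a}\<close> and \<open>F b\<close> on \<open>{a<..b}\<close>. This budget is used later
  with \<alpha> as either of the two breakpoints.\<close>

lemma p_to_e_calibrator_step_le_1:
  assumes F: "p_to_e_calibrator F" and ab: "0 \<le> a" "a \<le> b" "b \<le> 1"
  shows "ennreal a * F a + ennreal (b - a) * F b \<le> 1"
proof -
  \<comment> \<open>The uniform law, under which the identity satisfies the p-variable bound with
    equality.\<close>
  define M :: "real measure" where "M = restrict_space lborel {0..1}"
  have spM: "space M = {0..1}"
    by (simp add: M_def space_restrict_space)
  have emM: "emeasure M A = emeasure lborel A" if "A \<subseteq> {0..1}" for A
    unfolding M_def using that by (intro emeasure_restrict_space) auto
  have setsM: "A \<in> sets M" if "A \<in> sets borel" "A \<subseteq> {0..1}" for A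
    using that unfolding M_def by (subst sets_restrict_space_iff) auto
  have "prob_space M"
    by (rule prob_spaceI) (simp add: spM emM)
  moreover have "p_variable M (\<lambda>\<omega>. \<omega>)"
    unfolding p_variable_def
  proof (intro conjI ballI)
    show "(\<lambda>\<omega>. \<omega>) \<in> borel_measurable M"
      unfolding M_def by (intro measurable_restrict_space1) simp
  next
    fix \<delta> :: real assume d: "\<delta> \<in> {0<..<1}"
    then have "{\<omega> \<in> space M. \<omega> \<le> \<delta>} = {0..\<delta>}" by (auto simp: spM)
    then show "measure M {\<omega> \<in> space M. \<omega> \<le> \<delta>} \<le> \<delta>"
      using d by (simp add: measure_def emM)
  qed (simp add: spM)
  ultimately have le1: "(\<integral>\<^sup>+\<omega>. F \<omega> \<partial>M) \<le> 1"
    using F by (auto simp: p_to_e_calibrator_def e_variable_def)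
  have anti: "antimono_on {0..1} F" using F by (simp add: p_to_e_calibrator_def)
  have sub: "{0..a} \<subseteq> {0..1}" "{a<..b} \<subseteq> {0..1}" using ab by auto
  have sets: "{0..a} \<in> sets M" "{a<..b} \<in> sets M"
    using sub by (auto intro: setsM)
  have "ennreal a * F a + ennreal (b - a) * F b
      = (\<integral>\<^sup>+\<omega>. F a * indicator {0..a} \<omega> \<partial>M) + (\<integral>\<^sup>+\<omega>. F b * indicator {a<..b} \<omega> \<partial>M)"
    using ab sets by (simp add: nn_integral_cmult_indicator emM sub mult.commute)
  also have "\<dots> = (\<integral>\<^sup>+\<omega>. F a * indicator {0..a} \<omega> + F b * indicator {a<..b} \<omega> \<partial>M)"
    using sets by (intro nn_integral_add[symmetric]) auto
  also have "\<dots> \<le> (\<integral>\<^sup>+\<omega>. F \<omega> \<partial>M)"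
    using anti ab by (intro nn_integral_mono) (auto simp: spM indicator_def monotone_on_def)
  finally show ?thesis using le1 by (rule order_trans)
qed

text \<open>
  The joint law of the data need not be exchangeable, so the \<open>i\<close>-th response may be taken uniform
  on \<open>(i, i + 1)\<close>: with the score \<open>s(x, y) = y\<close>, the order of the scores is then deterministic.
\<close>

lemma set_preserving_rational:
  fixes \<X> :: "(real ^ 'd) set"
  assumes sp: "set_preserving \<alpha> \<X> F" and ne: "\<X> \<noteq> {}" and k: "1 \<le> k" "k \<le> n + 1"
  shows "\<alpha> < real k / (real n + 1) \<longleftrightarrow> F (real k / (real n + 1)) < ennreal (1 / \<alpha>)"
proof -
  obtain x0 where x0: "x0 \<in> \<X>" using ne by auto
  let ?L = "\<Pi>\<^sub>M i\<in>{1..n}. (lborel :: real measure)"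
  interpret product_sigma_finite "\<lambda>_ :: nat. lborel :: real measure"
    by standard
  \<comment> \<open>Unit sides give volume 1. The sides are pairwise disjoint, which fixes the order
    of the coordinates.\<close>
  define box where "box = (\<Pi>\<^sub>E i\<in>{1..n}. {real i<..<real i + 1})"
  define N where "N = uniform_measure ?L box"
  \<comment> \<open>All inputs sit at the single point \<open>x0\<close>; only the responses are
    random.\<close>
  define g where "g w = (\<lambda>i\<in>{1..n}. (x0, w i :: real), x0)" for w
  define Q where "Q = distr N (data_space n \<X>) g"
  define s :: "real ^ 'd \<Rightarrow> real \<Rightarrow> real" where "s = (\<lambda>x y. y)"
  have box: "box \<in> sets ?L"
    unfolding box_def by (intro sets_PiM_I_finite) auto
  have "emeasure ?L box = (\<Prod>i\<in>{1..n}. emeasure lborel {real i<..<real i + 1})"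
    unfolding box_def by (intro emeasure_PiM) auto
  then have embox: "emeasure ?L box = 1" by simp
  interpret N: prob_space N
    unfolding N_def by (intro prob_space_uniform_measure) (simp_all only: embox ennreal_one_neq_top one_neq_zero infinity_ennreal_def not_False_eq_True)
  have setsN [measurable_cong]: "sets N = sets ?L" by (simp add: N_def)
  have g [measurable]: "g \<in> N \<rightarrow>\<^sub>M data_space n \<X>"
    unfolding g_def data_space_def using x0
    by (auto intro!: measurable_Pair measurable_restrict simp: space_restrict_space
        intro: measurable_component_singleton)
  have "nonconformity_score \<X> s"
    by (simp add: nonconformity_score_def s_def)
  moreover have "prob_space Q"
    unfolding Q_def by (intro N.prob_space_distr g)
  moreover have "sets Q = sets (data_space n \<X>)"
    by (simp add: Q_def)
  moreover have "continuous_scores n s Q"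
  proof -
    let ?S = "\<lambda>(z, x :: real ^ 'd). \<lambda>i\<in>{1..n}. s (fst (z i)) (snd (z i))"
    have S: "?S \<in> data_space n \<X> \<rightarrow>\<^sub>M ?L"
      unfolding data_space_def s_def by measurable
    have "distr Q ?L ?S = distr N ?L (?S \<circ> g)"
      unfolding Q_def by (rule distr_distr[OF S g])
    \<comment> \<open>Reading off the scores undoes \<open>g\<close>: points of \<open>N\<close> are
      extensional, so restricting to \<open>{1..n}\<close> changes nothing. The score law is thus
      \<open>N\<close> itself, which has a density.\<close>
    also have "\<dots> = distr N N (\<lambda>w. w)"
    proof (rule distr_cong)
      fix w assume "w \<in> space N"
      then have "w \<in> extensional {1..n}" by (auto simp: N_def space_PiM PiE_def)
      then show "(?S \<circ> g) w = w"
        by (auto simp: g_def s_def fun_eq_iff extensional_def restrict_def)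
    qed (simp_all add: setsN)
    also have "\<dots> = N" by (rule distr_id)
    finally show ?thesis
      unfolding continuous_scores_def N_def uniform_measure_def
      using box by (simp add: absolutely_continuousI_density)
  qed
  ultimately have "AE (z, x) in Q. {y. conformal_pvalue n s z x y > \<alpha>}
                       = {y. F (conformal_pvalue n s z x y) < ennreal (1 / \<alpha>)}"
    using sp unfolding set_preserving_def by blast
  then have "AE w in N. case g w of (z, x) \<Rightarrow> {y. conformal_pvalue n s z x y > \<alpha>}
                       = {y. F (conformal_pvalue n s z x y) < ennreal (1 / \<alpha>)}"
    unfolding Q_def by (rule AE_distrD[OF g])
  moreover have "AE w in N. w \<in> box"
    unfolding N_def using box by (intro AE_uniform_measureI) auto
  ultimately have ae: "AE w in N. w \<in> box \<and> (case g w of (z, x) \<Rightarrow>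
      {y. conformal_pvalue n s z x y > \<alpha>} = {y. F (conformal_pvalue n s z x y) < ennreal (1 / \<alpha>)})"
    by eventually_elim simp
  \<comment> \<open>An almost sure property of a probability measure holds at some point. The set
    equality there covers all \<open>y\<close> at once, so \<open>y\<close> may be chosen
    afterwards.\<close>
  obtain w where w: "w \<in> box" and eq: "case g w of (z, x) \<Rightarrow>
      {y. conformal_pvalue n s z x y > \<alpha>} = {y. F (conformal_pvalue n s z x y) < ennreal (1 / \<alpha>)}"
    using eventually_happens'[OF N.ae_filter_bot ae] by (elim exE conjE) rule
  \<comment> \<open>The test response will be \<open>real j\<close>. On \<open>box\<close> exactly
    the scores with index at least \<open>j\<close> reach it, which are
    \<open>n + 1 - j = k - 1\<close> many; the extra 1 in the p-value makes this
    \<open>k\<close>.\<close>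
  define j where "j = n + 2 - k"
  have j: "1 \<le> j" "j \<le> n + 1" using k by (auto simp: j_def)
  have ge: "w i \<ge> real j \<longleftrightarrow> j \<le> i" if "i \<in> {1..n}" for i
  proof -
    have "real i < w i" "w i < real i + 1" using w that by (auto simp: box_def)
    then show ?thesis by linarith
  qed
  have "(\<Sum>i = 1..n. of_bool (w i \<ge> real j)) = (\<Sum>i = 1..n. of_bool (j \<le> i) :: real)"
    by (intro sum.cong) (auto simp: ge)
  also have "\<dots> = real (card {j..n})"
  proof -
    have "{1..n} \<inter> {i. j \<le> i} = {j..n}" using j by auto
    then show ?thesis by (simp add: of_bool_def sum.If_cases)
  qed
  also have "\<dots> = real k - 1" using k by (simp add: j_def of_nat_diff)
  finally have "conformal_pvalue n s (fst (g w)) (snd (g w)) (real j) = real k / (real n + 1)"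
    by (simp add: conformal_pvalue_def s_def g_def)
  then show ?thesis using eq by (auto simp: set_eq_iff split_beta dest: spec[of _ "real j"])
qed

text \<open>If \<alpha> is irrational, it is not itself a conformal p-value, so the bound is carried
  to it from the left: first to every x < \<alpha> through a rational between x and \<alpha>, then
  to the limit.\<close>

lemma set_preserving_ge:
  fixes \<X> :: "(real ^ 'd) set"
  assumes lc: "left_continuous F" and sp: "set_preserving \<alpha> \<X> F" and ne: "\<X> \<noteq> {}"
    and anti: "antimono_on {0..1} F" and \<alpha>: "0 < \<alpha>" "\<alpha> < 1"
  shows "F \<alpha> \<ge> ennreal (1 / \<alpha>)"
proof -
  have ge: "F x \<ge> ennreal (1 / \<alpha>)" if x: "0 < x" "x < \<alpha>" for x
  proof -
    obtain r where r: "r \<in> \<rat>" "x < r" "r < \<alpha>" using Rats_dense_in_real[OF x(2)] by auto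
    then obtain m d :: nat where "d \<noteq> 0" and md: "\<bar>r\<bar> = real m / real d"
      by (auto elim: Rats_abs_nat_div_natE)
    \<comment> \<open>The sample size is \<open>n = d - 1\<close>; the truncated subtraction is
      exact because \<open>d\<close> is nonzero.\<close>
    then have "r = real m / (real (d - 1) + 1)" using r x by simp
    moreover have "0 < real m / real d" "real m / real d < 1"
      using md r x \<alpha> by simp_all
    then have "m \<noteq> 0" "m < d"
      using \<open>d \<noteq> 0\<close> by (cases "m = 0"; simp add: divide_less_eq_1)+
    then have "1 \<le> m" "m \<le> d - 1 + 1" by linarith+
    ultimately have "F r \<ge> ennreal (1 / \<alpha>)"
      using set_preserving_rational[OF sp ne, of m "d - 1"] r by (auto simp: not_less)
    also have "F r \<le> F x" using anti r x \<alpha> by (auto simp: monotone_on_def)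
    finally show ?thesis .
  qed
  have "(F \<longlongrightarrow> F \<alpha>) (at_left \<alpha>)"
    using lc \<alpha> by (auto simp: left_continuous_def continuous_within)
  moreover have "eventually (\<lambda>x. F x \<ge> ennreal (1 / \<alpha>)) (at_left \<alpha>)"
    using eventually_at_left_real[OF \<alpha>(1)] by eventually_elim (auto intro: ge)
  ultimately show ?thesis
    by (intro tendsto_lowerbound) auto
qed

lemma F_AoN_unique:
  assumes F: "p_to_e_calibrator F" and ge: "F \<alpha> \<ge> ennreal (1 / \<alpha>)"
    and \<alpha>: "0 < \<alpha>" "\<alpha> < 1" and p: "0 < p" "p \<le> 1"
  shows "F p = F_AoN \<alpha> p"
proof (cases "p \<le> \<alpha>")
  case True
  have anti: "antimono_on {0..1} F" using F by (simp add: p_to_e_calibrator_def)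
  have le1: "ennreal p * F p + ennreal (\<alpha> - p) * F \<alpha> \<le> 1"
    using p_to_e_calibrator_step_le_1[OF F, of p \<alpha>] True p \<alpha> by simp
  have lower: "F p \<ge> ennreal (1 / \<alpha>)"
    using order_trans[OF ge] anti True p \<alpha> by (auto simp: monotone_on_def)
  \<comment> \<open>The interval from p to \<alpha> costs at least (\<alpha> - p) / \<alpha>,
    leaving at most p / \<alpha> for \<open>p * F p\<close>.\<close>
  have "ennreal p * F p + ennreal ((\<alpha> - p) / \<alpha>) \<le> 1"
  proof -
    have "ennreal ((\<alpha> - p) / \<alpha>) = ennreal (\<alpha> - p) * ennreal (1 / \<alpha>)"
      using True \<alpha> by (simp flip: ennreal_mult)
    also have "\<dots> \<le> ennreal (\<alpha> - p) * F \<alpha>" by (intro mult_left_mono ge) simp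
    finally show ?thesis using le1 by (meson add_left_mono order_trans)
  qed
  \<comment> \<open>An infinite \<open>F p\<close> would make the product with p > 0 infinite,
    against the bound; otherwise this is real arithmetic.\<close>
  then have "F p \<le> ennreal (1 / \<alpha>)"
  proof (cases "F p")
    case (real r)
    have "ennreal (p * r + (\<alpha> - p) / \<alpha>) \<le> 1"
      using \<open>ennreal p * F p + ennreal ((\<alpha> - p) / \<alpha>) \<le> 1\<close> real p \<alpha> True by (simp add: ennreal_mult)
    then have "p * r + (\<alpha> - p) / \<alpha> \<le> 1" by simp
    then have "p * r \<le> p * (1 / \<alpha>)" using \<alpha> by (simp add: field_simps)
    then have "r \<le> 1 / \<alpha>" using p by (subst (asm) mult_le_cancel_left_pos)
    then show ?thesis using real by (simp add: ennreal_leI)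
  qed (use p in \<open>auto simp: ennreal_mult_top top_unique\<close>)
  with lower True show ?thesis by (simp add: F_AoN_def)
next
  case False
  have le1: "ennreal \<alpha> * F \<alpha> + ennreal (p - \<alpha>) * F p \<le> 1"
    using p_to_e_calibrator_step_le_1[OF F, of \<alpha> p] False p \<alpha> by simp
  have "1 = ennreal \<alpha> * ennreal (1 / \<alpha>)" using \<alpha> by (simp flip: ennreal_mult)
  also have "\<dots> \<le> ennreal \<alpha> * F \<alpha>" by (intro mult_left_mono ge) simp
  \<comment> \<open>The part up to \<alpha> already costs 1. Cancelling is sound in
    \<open>ennreal\<close> because 1 is finite.\<close>
  finally have "1 + ennreal (p - \<alpha>) * F p \<le> 1 + 0"
    using le1 by (simp add: add_right_mono order_trans[rotated])
  then have "ennreal (p - \<alpha>) * F p = 0" by (subst (asm) ennreal_add_left_cancel_le) simp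
  then show ?thesis using False by (simp add: F_AoN_def)
qed

theorem proposition2p3:
  fixes \<alpha> :: real and \<X> :: "(real ^ 'd) set"
  assumes "0 < \<alpha>" and "\<alpha> < 1" and "\<X> \<noteq> {}"
  shows "left_continuous (F_AoN \<alpha>) \<and> p_to_e_calibrator (F_AoN \<alpha>) \<and> set_preserving \<alpha> \<X> (F_AoN \<alpha>) \<and>
         (\<forall>F. left_continuous F \<and> p_to_e_calibrator F \<and> set_preserving \<alpha> \<X> F \<longrightarrow>
              (\<forall>p\<in>{0<..1}. F p = F_AoN \<alpha> p))"
proof (intro conjI allI impI ballI)
  fix F and p :: real
  assume F: "left_continuous F \<and> p_to_e_calibrator F \<and> set_preserving \<alpha> \<X> F"
    and p: "p \<in> {0<..1}"
  then have "F \<alpha> \<ge> ennreal (1 / \<alpha>)"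
    using assms by (intro set_preserving_ge) (auto simp: p_to_e_calibrator_def)
  with F p assms show "F p = F_AoN \<alpha> p" by (intro F_AoN_unique) auto
qed (use assms in \<open>auto intro: left_continuous_F_AoN p_to_e_calibrator_F_AoN set_preserving_F_AoN\<close>)

end
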